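(* There is an algorithm which, given integers $n,m>1$, computes the number of diagonals of the graph $G_{n,m,2}$, and whose running time is $\mathcal{O}(\log n)$.
   Context: The graph $G_{n,m,2}$ (an augmented directed grid graph on a two-holed torus): its vertices are the $4nm$ cells $(i,c)$ of a grid with $2n$ rows $0\le i<2n$ (row $0$ on top) and $2m$ columns $0\le c<2m$ (column $0$ leftmost). The bijection $u$ ("up") on cells is $u(i,c)=(i-1,c)$ if $i\ge 1$, and $u(0,c)=(2n-1,(c+m)\bmod 2m)$. The bijection $r$ ("right") on cells is $r(i,c)=(i,c+1)$ if $c<2m-1$, and $r(i,2m-1)=((i+n)\bmod 2n,0)$. The directed edges are $(\alpha,u\alpha)$ and $(\alpha,r\alpha)$ for every cell $\alpha$. A diagonal is a set $\{\alpha,u^{-1}r\alpha,(u^{-1}r)^2\alpha,\dots\}$ for a cell $\alpha$, i.e. an orbit of the permutation $u^{-1}r$ (apply $r$ first, then $u^{-1}$) on cells. Running time is measured by the number of elementary arithmetic operations (addition, subtraction, multiplication, division with remainder, comparison) on integers. *)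

theory Defs
  imports Complex_Main "Graph_Theory.Pair_Digraph"
begin

section \<open>The augmented grid graph on the two-holed torus\<close>

record 'v augmented_digraph = "'v pair_pre_digraph" +
  up :: "'v \<Rightarrow> 'v"
  right :: "'v \<Rightarrow> 'v"

type_synonym cell = "nat \<times> nat"

definition cells :: "nat \<Rightarrow> nat \<Rightarrow> cell set" where
  "cells n m = {0..<2 * n} \<times> {0..<2 * m}"

fun up_cell :: "nat \<Rightarrow> nat \<Rightarrow> cell \<Rightarrow> cell" where
  "up_cell n m (i, c) = (if i \<ge> 1 then (i - 1, c) else (2 * n - 1, (c + m) mod (2 * m)))"

fun right_cell :: "nat \<Rightarrow> nat \<Rightarrow> cell \<Rightarrow> cell" where
  "right_cell n m (i, c) = (if c < 2 * m - 1 then (i, c + 1) else ((i + n) mod (2 * n), 0))"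

definition grid_graph :: "nat \<Rightarrow> nat \<Rightarrow> cell augmented_digraph" where
  "grid_graph n m =
    \<lparr> pverts = cells n m,
      parcs = {(\<alpha>, up_cell n m \<alpha>) | \<alpha>. \<alpha> \<in> cells n m} \<union> {(\<alpha>, right_cell n m \<alpha>) | \<alpha>. \<alpha> \<in> cells n m},
      up = up_cell n m,
      right = right_cell n m \<rparr>"

definition diagonal_step :: "('v, 'b) augmented_digraph_scheme \<Rightarrow> 'v \<Rightarrow> 'v" where
  "diagonal_step G \<alpha> = inv_into (pverts G) (up G) (right G \<alpha>)"

definition diagonal :: "('v, 'b) augmented_digraph_scheme \<Rightarrow> 'v \<Rightarrow> 'v set" where
  "diagonal G \<alpha> = {(diagonal_step G ^^ k) \<alpha> | k. True}"

definition diagonals :: "('v, 'b) augmented_digraph_scheme \<Rightarrow> 'v set set" where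
  "diagonals G = diagonal G ` pverts G"

text \<open>The functions are bijections on the cells, so the use of \<open>inv_into\<close> above is meaningful.\<close>

lemma card_bij_cells:
  assumes "inj_on f (cells n m)" "f ` cells n m \<subseteq> cells n m"
  shows "bij_betw f (cells n m) (cells n m)"
  using assms by (simp add: bij_betw_def cells_def endo_inj_surj)

lemma half_turn_inj:
  fixes a b k :: nat
  assumes "a < 2 * k" "b < 2 * k" "(a + k) mod (2 * k) = (b + k) mod (2 * k)"
  shows "a = b"
proof -
  have "(x + k) mod (2 * k) = (if x < k then x + k else x - k)" if "x < 2 * k" for x
  proof (cases "x < k")
    case False
    then have "x + k = (x - k) + 2 * k" using that by simp
    then have "(x + k) mod (2 * k) = (x - k) mod (2 * k)" by (metis mod_add_self2)
    then show ?thesis using False that by simp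
  qed simp
  then show ?thesis
    using assms by (auto split: if_splits)
qed

lemma bij_betw_up_cell: "bij_betw (up_cell n m) (cells n m) (cells n m)"
proof (rule card_bij_cells)
  show "inj_on (up_cell n m) (cells n m)"
  proof (rule inj_onI, clarify)
    fix i c j d
    assume "(i, c) \<in> cells n m" "(j, d) \<in> cells n m" "up_cell n m (i, c) = up_cell n m (j, d)"
    then show "i = j \<and> c = d"
      using half_turn_inj[of c m d]
      by (cases "i \<ge> 1"; cases "j \<ge> 1") (simp_all add: cells_def, linarith+)
  qed
  have "up_cell n m (i, c) \<in> cells n m" if "(i, c) \<in> cells n m" for i c
    using that by (cases "i \<ge> 1") (simp_all add: cells_def less_imp_diff_less)
  then show "up_cell n m ` cells n m \<subseteq> cells n m"
    by force
qed

lemma bij_betw_right_cell: "bij_betw (right_cell n m) (cells n m) (cells n m)"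
proof (rule card_bij_cells)
  show "inj_on (right_cell n m) (cells n m)"
  proof (rule inj_onI, clarify)
    fix i c j d
    assume "(i, c) \<in> cells n m" "(j, d) \<in> cells n m" "right_cell n m (i, c) = right_cell n m (j, d)"
    then show "i = j \<and> c = d"
      using half_turn_inj[of i n j]
      by (cases "c < 2 * m - 1"; cases "d < 2 * m - 1") (simp_all add: cells_def, linarith?)
  qed
  have "right_cell n m (i, c) \<in> cells n m" if "(i, c) \<in> cells n m" for i c
    using that by (cases "c < 2 * m - 1") (simp_all add: cells_def)
  then show "right_cell n m ` cells n m \<subseteq> cells n m"
    by force
qed


section \<open>Algorithms on integers and their running time\<close>

text \<open>
  An algorithm is a program for a random-access machine whose memory cells hold arbitrary integers
  and are addressed by integers. Its running time is the number of arithmetic operations and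
  comparisons executed. Reads, writes and control flow are not charged; since every loop test
  contains at least one comparison, they affect the total number of steps of a fixed program
  only by a constant factor and an additive constant.
\<close>

datatype aexp =
    Const int
  | Cell aexp  \<comment> \<open>content of the memory cell with the given address\<close>
  | Add aexp aexp
  | Sub aexp aexp
  | Mul aexp aexp
  | Quot aexp aexp
  | Rem aexp aexp

datatype bexp =
    Less aexp aexp
  | Equal aexp aexp
  | Neg bexp
  | Conj bexp bexp

datatype program =
    Skip
  | Assign aexp aexp  \<comment> \<open>address and new content\<close>
  | Seq program program
  | Cond bexp program program
  | While bexp program

type_synonym memory = "int \<Rightarrow> int"

text \<open>
  Division rounds towards minus infinity; \<open>a div 0 = 0\<close> and \<open>a mod 0 = a\<close>.
\<close>

primrec aval :: "aexp \<Rightarrow> memory \<Rightarrow> int" where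
  "aval (Const k) s = k"
| "aval (Cell a) s = s (aval a s)"
| "aval (Add a b) s = aval a s + aval b s"
| "aval (Sub a b) s = aval a s - aval b s"
| "aval (Mul a b) s = aval a s * aval b s"
| "aval (Quot a b) s = aval a s div aval b s"
| "aval (Rem a b) s = aval a s mod aval b s"

primrec bval :: "bexp \<Rightarrow> memory \<Rightarrow> bool" where
  "bval (Less a b) s \<longleftrightarrow> aval a s < aval b s"
| "bval (Equal a b) s \<longleftrightarrow> aval a s = aval b s"
| "bval (Neg b) s \<longleftrightarrow> \<not> bval b s"
| "bval (Conj b c) s \<longleftrightarrow> bval b s \<and> bval c s"

primrec acost :: "aexp \<Rightarrow> nat" where
  "acost (Const k) = 0"
| "acost (Cell a) = acost a"
| "acost (Add a b) = acost a + acost b + 1"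
| "acost (Sub a b) = acost a + acost b + 1"
| "acost (Mul a b) = acost a + acost b + 1"
| "acost (Quot a b) = acost a + acost b + 1"
| "acost (Rem a b) = acost a + acost b + 1"

primrec bcost :: "bexp \<Rightarrow> nat" where
  "bcost (Less a b) = acost a + acost b + 1"
| "bcost (Equal a b) = acost a + acost b + 1"
| "bcost (Neg b) = bcost b"
| "bcost (Conj b c) = bcost b + bcost c"

text \<open>
  \<open>runs P s t s'\<close>: started in memory \<open>s\<close>, the program \<open>P\<close> terminates in memory \<open>s'\<close> after
  \<open>t\<close> elementary operations.
\<close>

inductive runs :: "program \<Rightarrow> memory \<Rightarrow> nat \<Rightarrow> memory \<Rightarrow> bool" where
  Skip: "runs Skip s 0 s"
| Assign: "runs (Assign a b) s (acost a + acost b) (s(aval a s := aval b s))"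
| Seq: "runs P s t s' \<Longrightarrow> runs Q s' t' s'' \<Longrightarrow> runs (Seq P Q) s (t + t') s''"
| CondTrue: "bval b s \<Longrightarrow> runs P s t s' \<Longrightarrow> runs (Cond b P Q) s (bcost b + t) s'"
| CondFalse: "\<not> bval b s \<Longrightarrow> runs Q s t s' \<Longrightarrow> runs (Cond b P Q) s (bcost b + t) s'"
| WhileFalse: "\<not> bval b s \<Longrightarrow> runs (While b P) s (bcost b) s"
| WhileTrue: "bval b s \<Longrightarrow> runs P s t s' \<Longrightarrow> runs (While b P) s' t' s'' \<Longrightarrow>
    runs (While b P) s (bcost b + t + t') s''"

inductive_cases SkipE: "runs Skip s t s'"
  and AssignE: "runs (Assign a b) s t s'"
  and SeqE: "runs (Seq P Q) s t s'"
  and CondE: "runs (Cond b P Q) s t s'"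
  and WhileE: "runs (While b P) s t s'"

lemma runs_deterministic:
  "runs P s t s' \<Longrightarrow> runs P s u s'' \<Longrightarrow> t = u \<and> s' = s''"
proof (induction arbitrary: u s'' rule: runs.induct)
  case Skip
  then show ?case by (rule SkipE) simp
next
  case Assign
  then show ?case by (rule AssignE) simp
next
  case Seq
  from Seq.prems show ?case by (rule SeqE) (use Seq.IH in blast)
next
  case CondTrue
  from CondTrue.prems show ?case by (rule CondE) (use CondTrue.IH CondTrue.hyps in blast)+
next
  case CondFalse
  from CondFalse.prems show ?case by (rule CondE) (use CondFalse.IH CondFalse.hyps in blast)+
next
  case WhileFalse
  from WhileFalse.prems show ?case by (rule WhileE) (use WhileFalse.hyps in blast)+
next
  case WhileTrue
  from WhileTrue.prems show ?case by (rule WhileE) (use WhileTrue.IH WhileTrue.hyps in blast)+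
qed

text \<open>The inputs are placed in cells 0 and 1, and the result is expected in cell 0.\<close>

definition initial :: "int \<Rightarrow> int \<Rightarrow> memory" where
  "initial x y = (\<lambda>_. 0)(0 := x, 1 := y)"

definition result :: "memory \<Rightarrow> int" where
  "result s = s 0"

end

theory Submission
  imports Defs
begin

text \<open>
  Cut the torus into its four \<open>n \<times> m\<close> blocks. A diagonal crosses each block along a segment, and
  recording the segment and the block (the sheet) turns the diagonals into the orbits of a
  four-sheeted skew product over the exchange of two intervals of lengths \<open>n\<close> and \<open>m\<close>: a point
  \<open>x < n\<close> moves to \<open>x + m\<close> while its sheet is changed by the permutation \<open>R\<close> (leave to the
  right), every other point moves to \<open>x - n\<close> while its sheet is changed by \<open>D\<close> (leave downwards).
  Inducing on the first return to a subinterval replaces \<open>(n, m, R, D)\<close> by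
  \<open>(m mod n, n, D, D\<^sup>q R)\<close> with \<open>q = m div n\<close>, without changing the number of orbits. This is
  the Euclidean algorithm. At its end \<open>(0, g, A, B)\<close> there are \<open>g\<close> orbits for every cycle of \<open>B\<close>.
  Pairs of sheet permutations form a finite set on which \<open>q\<close> matters only modulo a fixed period,
  so a constant table performs the update of the pair with a bounded number of operations.
\<close>

section \<open>Counting orbits\<close>

text \<open>Forward orbits that meet: an equivalence relation for every \<open>f\<close>, so the
  maps compared later need not be shown invertible.\<close>

definition same_orbit :: "('a \<Rightarrow> 'a) \<Rightarrow> 'a \<Rightarrow> 'a \<Rightarrow> bool" where
  "same_orbit f x y \<longleftrightarrow> (\<exists>k l. (f ^^ k) x = (f ^^ l) y)"

definition orbit_in :: "('a \<Rightarrow> 'a) \<Rightarrow> 'a set \<Rightarrow> 'a \<Rightarrow> 'a set" where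
  "orbit_in f X x = {y \<in> X. same_orbit f x y}"

definition orbit_count :: "('a \<Rightarrow> 'a) \<Rightarrow> 'a set \<Rightarrow> nat" where
  "orbit_count f X = card (orbit_in f X ` X)"

lemma same_orbit_refl [simp]: "same_orbit f x x"
  unfolding same_orbit_def by blast

lemma same_orbit_sym: "same_orbit f x y \<Longrightarrow> same_orbit f y x"
  unfolding same_orbit_def by metis

lemma same_orbit_trans:
  assumes "same_orbit f x y" "same_orbit f y z"
  shows "same_orbit f x z"
proof -
  obtain k l k' l' where "(f ^^ k) x = (f ^^ l) y" "(f ^^ k') y = (f ^^ l') z"
    using assms unfolding same_orbit_def by blast
  moreover have "(f ^^ k') ((f ^^ l) y) = (f ^^ l) ((f ^^ k') y)"
    by (metis add.commute comp_apply funpow_add)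
  ultimately have "(f ^^ (k' + k)) x = (f ^^ (l + l')) z"
    by (simp add: funpow_add)
  then show ?thesis unfolding same_orbit_def by blast
qed

lemma same_orbit_funpow: "same_orbit f x ((f ^^ k) x)"
  unfolding same_orbit_def by (rule exI[of _ k], rule exI[of _ 0]) simp

lemma same_orbit_step: "same_orbit f x (f x)"
  using same_orbit_funpow[of f x 1] by simp

lemma same_orbit_stepsI:
  assumes "y = x \<or> y = f x \<or> y = f (f x)"
  shows "same_orbit f x y"
  using assms same_orbit_funpow[of f x 2] by (auto simp: numeral_2_eq_2 intro: same_orbit_step)

lemma orbit_in_eq_iff:
  assumes "x \<in> X" "y \<in> X"
  shows "orbit_in f X x = orbit_in f X y \<longleftrightarrow> same_orbit f x y"
  using assms unfolding orbit_in_def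
  by (auto intro: same_orbit_trans dest: same_orbit_sym)

lemma funpow_mem: "(\<And>x. x \<in> X \<Longrightarrow> f x \<in> X) \<Longrightarrow> x \<in> X \<Longrightarrow> (f ^^ k) x \<in> X"
  by (induction k) auto

lemma same_orbit_map:
  assumes "\<And>x. x \<in> X \<Longrightarrow> f x \<in> X"
    and "\<And>x. x \<in> X \<Longrightarrow> same_orbit g (h x) (h (f x))"
    and "x \<in> X" "y \<in> X" "same_orbit f x y"
  shows "same_orbit g (h x) (h y)"
proof -
  have *: "same_orbit g (h z) (h ((f ^^ k) z))" if "z \<in> X" for z k
  proof (induction k)
    case (Suc k)
    then show ?case
      using assms(2)[OF funpow_mem[OF assms(1) that]] by (auto intro: same_orbit_trans)
  qed simp
  obtain k l where "(f ^^ k) x = (f ^^ l) y"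
    using assms(5) unfolding same_orbit_def by blast
  then show ?thesis
    using *[of x k] *[of y l] assms(3,4) by (metis same_orbit_sym same_orbit_trans)
qed

text \<open>Both images are in bijection with the quotient of \<open>X\<close> by the common
  kernel.\<close>

lemma card_image_cong_kernel:
  assumes "\<And>x y. x \<in> X \<Longrightarrow> y \<in> X \<Longrightarrow> F x = F y \<longleftrightarrow> G x = G y"
  shows "card (F ` X) = card (G ` X)"
proof (rule bij_betw_same_card)
  have *: "G (inv_into X F (F x)) = G x" if "x \<in> X" for x
    using assms[of "inv_into X F (F x)" x] that
    by (simp add: f_inv_into_f inv_into_into)
  show "bij_betw (\<lambda>c. G (inv_into X F c)) (F ` X) (G ` X)"
    unfolding bij_betw_def inj_on_def using * assms by (auto simp: image_iff)
qed

text \<open>\<open>h\<close> and \<open>k\<close> are inverse only up to orbits. \<open>hf\<close>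
  and \<open>kg\<close> make them well defined on orbits, \<open>kh\<close> and \<open>hk\<close>
  make the induced maps mutually inverse. This covers first return maps and maps that collapse whole
  segments.\<close>

lemma orbit_count_eqI:
  assumes f: "\<And>x. x \<in> X \<Longrightarrow> f x \<in> X" and g: "\<And>y. y \<in> Y \<Longrightarrow> g y \<in> Y"
    and h: "\<And>x. x \<in> X \<Longrightarrow> h x \<in> Y" and k: "\<And>y. y \<in> Y \<Longrightarrow> k y \<in> X"
    and hf: "\<And>x. x \<in> X \<Longrightarrow> same_orbit g (h x) (h (f x))"
    and kg: "\<And>y. y \<in> Y \<Longrightarrow> same_orbit f (k y) (k (g y))"
    and kh: "\<And>x. x \<in> X \<Longrightarrow> same_orbit f (k (h x)) x"
    and hk: "\<And>y. y \<in> Y \<Longrightarrow> same_orbit g (h (k y)) y"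
  shows "orbit_count f X = orbit_count g Y"
proof -
  have eq: "same_orbit f x y \<longleftrightarrow> same_orbit g (h x) (h y)" if "x \<in> X" "y \<in> X" for x y
  proof
    assume "same_orbit g (h x) (h y)"
    then have "same_orbit f (k (h x)) (k (h y))"
      using same_orbit_map[of Y g f k] g kg h that by blast
    then show "same_orbit f x y"
      using kh that by (meson same_orbit_sym same_orbit_trans)
  qed (use same_orbit_map[of X f g h] f hf that in blast)
  have "orbit_in g Y ` Y = (orbit_in g Y \<circ> h) ` X"
  proof safe
    fix y assume y: "y \<in> Y"
    then have "orbit_in g Y y = (orbit_in g Y \<circ> h) (k y)"
      using hk[OF y] h k by (simp add: orbit_in_eq_iff same_orbit_sym)
    then show "orbit_in g Y y \<in> (orbit_in g Y \<circ> h) ` X"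
      using k y by blast
  qed (use h in auto)
  moreover have "card (orbit_in f X ` X) = card ((orbit_in g Y \<circ> h) ` X)"
    using h eq by (intro card_image_cong_kernel) (simp add: orbit_in_eq_iff)
  ultimately show ?thesis
    unfolding orbit_count_def by simp
qed

section \<open>Forward orbits of permutations of a finite set\<close>

lemma bij_betw_funpow_fixes:
  assumes "finite X" "bij_betw f X X" "x \<in> X"
  obtains p where "p > 0" "(f ^^ p) x = x"
proof -
  have mem: "(f ^^ k) x \<in> X" for k
    using assms(2,3) by (intro funpow_mem) (auto dest: bij_betwE)
  \<comment> \<open>Pigeonhole gives a repetition along the orbit; injectivity of
    \<open>f ^^ i\<close> then cancels the first \<open>i\<close> steps.\<close>
  have "\<not> inj (\<lambda>k. (f ^^ k) x)"
    using mem assms(1) by (meson finite_imageD finite_subset image_subsetI infinite_UNIV_nat)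
  then obtain i j where ij: "i < j" "(f ^^ i) x = (f ^^ j) x"
    unfolding inj_def by (metis linorder_neqE_nat)
  then have "(f ^^ i) x = (f ^^ i) ((f ^^ (j - i)) x)"
    using funpow_add[of i "j - i" f] by simp
  then have "(f ^^ (j - i)) x = x"
    using bij_betw_funpow[OF assms(2), of i] mem[of "j - i"] assms(3)
    by (auto simp: bij_betw_def dest!: inj_onD)
  then show ?thesis using that[of "j - i"] ij by simp
qed

lemma diagonals_eq_orbit_count:
  assumes "finite (pverts G)" "bij_betw (diagonal_step G) (pverts G) (pverts G)"
  shows "card (diagonals G) = orbit_count (diagonal_step G) (pverts G)"
proof -
  let ?f = "diagonal_step G"
  have sub: "diagonal G x \<subseteq> diagonal G y" if x: "x \<in> pverts G" and xy: "same_orbit ?f x y" for x y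
  proof -
    obtain k l where kl: "(?f ^^ k) x = (?f ^^ l) y"
      using xy unfolding same_orbit_def by blast
    obtain p where p: "p > 0" "(?f ^^ p) x = x"
      using bij_betw_funpow_fixes[OF assms x] by blast
    have per: "(?f ^^ (p * j)) x = x" for j
      using p by (induction j) (simp_all add: funpow_add)
    \<comment> \<open>After \<open>k\<close> steps from \<open>x\<close>, another
      \<open>p * k - k\<close> steps complete \<open>k\<close> periods and return to
      \<open>x\<close>. So \<open>x\<close> itself lies on the forward orbit of
      \<open>y\<close>.\<close>
    have "k \<le> p * k" using p by simp
    then have "x = (?f ^^ (p * k - k + l)) y"
      using per[of k] kl funpow_add[of "p * k - k" k ?f] funpow_add[of "p * k - k" l ?f] by simp
    then have "(?f ^^ j) x = (?f ^^ (j + (p * k - k + l))) y" for j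
      by (simp add: funpow_add)
    then show ?thesis
      unfolding diagonal_def by blast
  qed
  have "diagonal G x = diagonal G y \<longleftrightarrow> same_orbit ?f x y"
    if "x \<in> pverts G" "y \<in> pverts G" for x y
  proof
    assume "diagonal G x = diagonal G y"
    moreover have "x \<in> diagonal G x"
      unfolding diagonal_def by (metis (mono_tags) funpow_0 mem_Collect_eq)
    ultimately obtain k where "x = (?f ^^ k) y"
      unfolding diagonal_def by blast
    then show "same_orbit ?f x y"
      using same_orbit_sym[OF same_orbit_funpow[of ?f y k]] by simp
  next
    assume xy: "same_orbit ?f x y"
    show "diagonal G x = diagonal G y"
      using sub[OF that(1) xy] sub[OF that(2) same_orbit_sym[OF xy]] by (rule equalityI)
  qed
  then show ?thesis
    unfolding diagonals_def orbit_count_def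
    by (intro card_image_cong_kernel) (simp add: orbit_in_eq_iff)
qed

section \<open>Skew products over exchanges of two intervals\<close>

text \<open>On the first coordinate this is rotation by \<open>b\<close> modulo
  \<open>a + b\<close>.\<close>

definition exch :: "nat \<Rightarrow> nat \<Rightarrow> ('s \<Rightarrow> 's) \<Rightarrow> ('s \<Rightarrow> 's) \<Rightarrow> nat \<times> 's \<Rightarrow> nat \<times> 's" where
  "exch a b A B = (\<lambda>(x, s). if x < a then (x + b, A s) else (x - a, B s))"

definition exch_orbits :: "nat \<Rightarrow> nat \<Rightarrow> ('s \<Rightarrow> 's) \<Rightarrow> ('s \<Rightarrow> 's) \<Rightarrow> nat" where
  "exch_orbits a b A B = orbit_count (exch a b A B) ({..<a + b} \<times> UNIV)"

lemma exch_mem: "z \<in> {..<a + b} \<times> UNIV \<Longrightarrow> exch a b A B z \<in> {..<a + b} \<times> UNIV"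
  by (auto simp: exch_def split: prod.splits)

text \<open>The reflection of the interval conjugates one exchange into the other.\<close>

lemma exch_orbits_swap: "exch_orbits a b A B = exch_orbits b a B A"
proof -
  let ?X = "{..<a + b} \<times> (UNIV :: 'a set)"
  let ?h = "\<lambda>(x, s :: 'a). (a + b - 1 - x, s)"
  have h: "?h z \<in> ?X" "?h (?h z) = z" if "z \<in> ?X" for z
    using that by auto
  have c: "?h (exch a b A B z) = exch b a B A (?h z)" "?h (exch b a B A z) = exch a b A B (?h z)"
    if "z \<in> ?X" for z
    using that by (auto simp: exch_def split: if_splits)
  have "orbit_count (exch a b A B) ?X = orbit_count (exch b a B A) ?X"
  proof (rule orbit_count_eqI[where h = ?h and k = ?h])
    show "exch b a B A z \<in> ?X" if "z \<in> ?X" for z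
      using exch_mem[of z b a] that by (simp add: add.commute)
  qed (simp_all only: c h exch_mem same_orbit_step same_orbit_refl)
  then show ?thesis
    unfolding exch_orbits_def by (simp add: add.commute)
qed

text \<open>Rauzy induction: the first return map to the points below \<open>a + b\<close>.\<close>

lemma exch_orbits_induce: "exch_orbits a (a + b) A B = exch_orbits a b (B \<circ> A) B"
  unfolding exch_orbits_def
\<comment> \<open>Points outside the subinterval are pushed one step forward into it. A point
  \<open>x < a\<close> leaves it, and its second step brings it back to \<open>x + b\<close>, which
  accounts for \<open>B \<circ> A\<close>; the other points of the subinterval return at
  once.\<close>
proof (rule orbit_count_eqI[where
      h = "\<lambda>(x, s). if x < a + b then (x, s) else (x - a, B s)" and k = "\<lambda>z. z"])
  let ?f = "exch a (a + b) A B" and ?g = "exch a b (B \<circ> A) B"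
  let ?h = "\<lambda>(x, s). if x < a + b then (x, s) else (x - a, B s)"
  show "same_orbit ?g (?h z) (?h (?f z))" if "z \<in> {..<a + (a + b)} \<times> UNIV" for z
    using that by (intro same_orbit_stepsI) (auto simp: exch_def split: if_splits)
  show "same_orbit ?f z (?g z)" if "z \<in> {..<a + b} \<times> UNIV" for z
    using that by (intro same_orbit_stepsI) (auto simp: exch_def split: if_splits)
  show "same_orbit ?f (?h z) z" if "z \<in> {..<a + (a + b)} \<times> UNIV" for z
    by (rule same_orbit_sym, rule same_orbit_stepsI, cases z) (auto simp: exch_def split: if_splits)
  show "?f z \<in> {..<a + (a + b)} \<times> UNIV" if "z \<in> {..<a + (a + b)} \<times> UNIV" for z
    using that by (rule exch_mem)
  show "?g z \<in> {..<a + b} \<times> UNIV" if "z \<in> {..<a + b} \<times> UNIV" for z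
    using that by (rule exch_mem)
qed (auto split: if_splits)

text \<open>One division step is \<open>b div a\<close> inductions, each composing one more
  \<open>B\<close> onto \<open>A\<close>, followed by a swap that puts the shorter interval
  first.\<close>

lemma exch_orbits_mod:
  "exch_orbits a b A B = exch_orbits (b mod a) a B ((B ^^ (b div a)) \<circ> A)"
proof -
  have "exch_orbits a (q * a + r) A B = exch_orbits a r ((B ^^ q) \<circ> A) B" for q r
  proof (induction q arbitrary: A)
    case (Suc q)
    have "exch_orbits a (Suc q * a + r) A B = exch_orbits a (q * a + r) (B \<circ> A) B"
      using exch_orbits_induce[of a "q * a + r" A B] by (simp add: ac_simps)
    also have "\<dots> = exch_orbits a r ((B ^^ Suc q) \<circ> A) B"
      by (simp only: Suc funpow_Suc_right comp_assoc)
    finally show ?case .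
  qed simp
  from this[of "b div a" "b mod a"] show ?thesis
    using exch_orbits_swap by (simp add: mult.commute)
qed

text \<open>With the first interval empty, base points stay fixed and \<open>B\<close> acts alone on
  each of the \<open>b\<close> fibres.\<close>

lemma exch_orbits_0: "exch_orbits 0 b A B = b * orbit_count B UNIV"
proof -
  let ?F = "\<lambda>(x :: nat, C :: 'a set). {x} \<times> C" and ?f = "exch 0 b A B"
  let ?X = "{..<b} \<times> (UNIV :: 'a set)"
  have f: "(?f ^^ k) (x, s) = (x, (B ^^ k) s)" for k x s
    by (induction k) (auto simp: exch_def)
  have so: "same_orbit ?f (x, s) (y, t) \<longleftrightarrow> x = y \<and> same_orbit B s t" for x y s t
    by (simp add: same_orbit_def f)
  have F: "orbit_in ?f ?X z = ?F (map_prod id (orbit_in B UNIV) z)" if "z \<in> ?X" for z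
    using that by (cases z) (auto simp: orbit_in_def so)
  have surj: "map_prod id (orbit_in B UNIV) ` ?X = {..<b} \<times> orbit_in B UNIV ` UNIV"
    by (rule map_prod_surj_on) simp_all
  have "orbit_in ?f ?X ` ?X = (\<lambda>z. ?F (map_prod id (orbit_in B UNIV) z)) ` ?X"
    using F by (rule image_cong[OF refl])
  also have "\<dots> = ?F ` ({..<b} \<times> orbit_in B UNIV ` UNIV)"
    by (simp only: surj[symmetric] image_image)
  finally have img: "orbit_in ?f ?X ` ?X = ?F ` ({..<b} \<times> orbit_in B UNIV ` UNIV)" .
  \<comment> \<open>The product with an empty set would forget \<open>x\<close>; nonempty orbits
    make \<open>?F\<close> injective.\<close>
  have ne: "s \<in> orbit_in B UNIV s" for s
    unfolding orbit_in_def by simp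
  have "inj_on ?F ({..<b} \<times> orbit_in B UNIV ` UNIV)"
  proof (rule inj_onI, clarsimp)
    fix x y :: nat and s t :: 'a assume eq: "{x} \<times> orbit_in B UNIV s = {y} \<times> orbit_in B UNIV t"
    then have "(x, s) \<in> {y} \<times> orbit_in B UNIV t"
      using ne[of s] by blast
    then show "x = y \<and> orbit_in B UNIV s = orbit_in B UNIV t"
      by (simp add: orbit_in_eq_iff) (simp add: orbit_in_def same_orbit_sym)
  qed
  then show ?thesis
    unfolding exch_orbits_def orbit_count_def by (simp add: img card_image card_cartesian_product)
qed

text \<open>Pigeonhole is applied to the maps \<open>B \<mapsto> B ^^ k\<close>, of which there are
  finitely many, so one pair \<open>i < j\<close> serves all \<open>B\<close> at once. Bijectivity
  cancels \<open>B ^^ i\<close>.\<close>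

lemma finite_uniform_period:
  obtains p :: nat where "p > 0" "\<And>B :: 's::finite \<Rightarrow> 's. bij B \<Longrightarrow> B ^^ p = id"
proof -
  have "\<not> inj (\<lambda>k (B :: 's \<Rightarrow> 's). B ^^ k)"
    using finite_imageD[of "\<lambda>k (B :: 's \<Rightarrow> 's). B ^^ k" UNIV] by auto
  then obtain i j where ij: "i < j" "\<And>B :: 's \<Rightarrow> 's. B ^^ i = B ^^ j"
    unfolding inj_def by (metis linorder_neqE_nat)
  have "B ^^ (j - i) = id" if "bij B" for B :: "'s \<Rightarrow> 's"
  proof -
    have "B ^^ i \<circ> B ^^ (j - i) = B ^^ i \<circ> id"
      using ij(1) ij(2)[of B] funpow_add[of i "j - i" B] by simp
    moreover have "inj (B ^^ i)"
      using that by (simp add: bij_is_inj)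
    ultimately show ?thesis
      by (simp add: fun_eq_iff inj_eq)
  qed
  then show ?thesis using that[of "j - i"] ij by simp
qed

section \<open>Diagonals as orbits of a skew product\<close>

text \<open>
  The torus consists of four \<open>n \<times> m\<close> blocks; a sheet \<open>(p, q)\<close> says whether a block lies in the
  lower half and whether it lies in the right half.
\<close>

type_synonym sheet = "bool \<times> bool"

text \<open>Leaving the right half wraps around with a shift by \<open>n\<close> rows, hence the
  vertical bit flips exactly when \<open>q\<close> holds. Dually, \<open>down_sheet\<close> flips
  the horizontal bit when leaving the lower half.\<close>

definition right_sheet :: "sheet \<Rightarrow> sheet" where
  "right_sheet = (\<lambda>(p, q). (p \<noteq> q, \<not> q))"

definition down_sheet :: "sheet \<Rightarrow> sheet" where
  "down_sheet = (\<lambda>(p, q). (\<not> p, q \<noteq> p))"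

lemma bij_right_sheet: "bij right_sheet"
  by (rule o_bij[of "\<lambda>(p, q). (p = q, \<not> q)"]) (auto simp: right_sheet_def fun_eq_iff)

lemma bij_down_sheet: "bij down_sheet"
  by (rule o_bij[of "\<lambda>(p, q). (\<not> p, q = p)"]) (auto simp: down_sheet_def fun_eq_iff)

definition place :: "nat \<Rightarrow> nat \<Rightarrow> nat \<Rightarrow> nat \<Rightarrow> sheet \<Rightarrow> cell" where
  "place n m i c s = (i + (if fst s then n else 0), c + (if snd s then m else 0))"

lemma place_mem: "i < n \<Longrightarrow> c < m \<Longrightarrow> place n m i c s \<in> cells n m"
  by (auto simp: place_def cells_def)

lemma cells_placeE:
  assumes "z \<in> cells n m"
  obtains i c s where "i < n" "c < m" "z = place n m i c s"
proof -
  obtain i c where z: "z = (i, c)" "i < 2 * n" "c < 2 * m"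
    using assms by (auto simp: cells_def)
  then have "z = place n m (if i < n then i else i - n) (if c < m then c else c - m) (n \<le> i, m \<le> c)"
    by (auto simp: place_def)
  then show ?thesis
    using z by (intro that) auto
qed

lemma half_turn_mod:
  assumes "(i :: nat) < n"
  shows "(i + n) mod (2 * n) = i + n" "(i + n + n) mod (2 * n) = i"
  using assms mod_add_self2[of i "2 * n"] by (simp_all add: mult_2 add.assoc)

lemma right_cell_place:
  assumes "i < n" "c < m"
  shows "right_cell n m (place n m i c s) =
    (if c + 1 < m then place n m i (c + 1) s else place n m i 0 (right_sheet s))"
  using assms half_turn_mod[of i n]
  by (cases s) (auto simp: place_def right_sheet_def)

text \<open>The downward move is given only as \<open>inv_into\<close> of \<open>up_cell\<close>;
  this exhibits the preimage.\<close>

lemma up_cell_place: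
  assumes "i < n" "c < m"
  shows "up_cell n m (if i + 1 < n then place n m (i + 1) c s else place n m 0 c (down_sheet s)) =
    place n m i c s"
  using assms half_turn_mod[of c m]
  by (cases s) (auto simp: place_def down_sheet_def)

lemma diagonal_step_place:
  assumes "i < n" "c < m"
  shows "diagonal_step (grid_graph n m) (place n m i c s) =
    (let (c', s') = (if c + 1 < m then (c + 1, s) else (0, right_sheet s))
     in if i + 1 < n then place n m (i + 1) c' s' else place n m 0 c' (down_sheet s'))"
proof -
  have inv: "inv_into (cells n m) (up_cell n m) (place n m i c s) =
      (if i + 1 < n then place n m (i + 1) c s else place n m 0 c (down_sheet s))"
    if "c < m" for c s
    using assms that bij_betw_up_cell[of n m]
    by (intro inv_into_f_eq up_cell_place) (auto simp: bij_betw_def intro: place_mem)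
  have "0 < m" using assms by simp
  then show ?thesis
    using assms inv by (simp add: diagonal_step_def grid_graph_def right_cell_place)
qed

text \<open>
  The label of a cell identifies the segment of its diagonal within its block: labels below \<open>n\<close>
  leave the block to the right, the others downwards.
\<close>

definition label :: "nat \<Rightarrow> nat \<Rightarrow> cell \<Rightarrow> nat \<times> sheet" where
  "label n m = (\<lambda>(i, c). (m - 1 - c mod m + i mod n, (n \<le> i, m \<le> c)))"

lemma label_place:
  assumes "i < n" "c < m"
  shows "label n m (place n m i c s) = (m - 1 - c + i, s)"
  using assms by (cases s) (auto simp: place_def label_def)

text \<open>
  The diagonal through a corner leaves a block to the right and then immediately downwards; the
  label \<open>n + m - 1\<close> in between belongs to no cell, and is sent to the cell reached next.
\<close>

definition entry_cell :: "nat \<Rightarrow> nat \<Rightarrow> nat \<times> sheet \<Rightarrow> cell" where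
  "entry_cell n m = (\<lambda>(x, s).
    if x < m then place n m 0 (m - 1 - x) s
    else if x + 1 < n + m then place n m (x + 1 - m) 0 s
    else place n m 0 0 (down_sheet s))"

lemma entry_cell_mem:
  assumes "0 < n" "0 < m" "y \<in> {..<n + m} \<times> UNIV"
  shows "entry_cell n m y \<in> cells n m"
  using assms by (auto simp: entry_cell_def intro!: place_mem)

text \<open>Walking backwards from \<open>(i, c)\<close> to \<open>(i - 1, c - 1)\<close> keeps the
  label and ends in the top row or left column of the block, at the entry cell.\<close>

lemma same_orbit_entry_cell:
  assumes "i < n" "c < m"
  shows "same_orbit (diagonal_step (grid_graph n m))
    (entry_cell n m (m - 1 - c + i, s)) (place n m i c s)"
  using assms
proof (induction c arbitrary: i)
  case 0
  then have "entry_cell n m (m - 1 - 0 + i, s) = place n m i 0 s"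
    by (cases i) (auto simp: entry_cell_def)
  then show ?case by simp
next
  case (Suc c)
  show ?case
  proof (cases i)
    case 0
    then have "entry_cell n m (m - 1 - Suc c + i, s) = place n m i (Suc c) s"
      using Suc.prems by (auto simp: entry_cell_def)
    then show ?thesis by simp
  next
    case (Suc j)
    have "diagonal_step (grid_graph n m) (place n m j c s) = place n m i (Suc c) s"
      using Suc Suc.prems by (simp add: diagonal_step_place)
    moreover have "m - 1 - Suc c + i = m - 1 - c + j"
      using Suc Suc.prems by simp
    ultimately show ?thesis
      using Suc.IH[of j] Suc Suc.prems same_orbit_trans same_orbit_step
      by (metis Suc_lessD)
  qed
qed

lemma same_orbit_entry_cell_exch:
  assumes "0 < n" "0 < m" "x < n + m"
  shows "same_orbit (diagonal_step (grid_graph n m)) (entry_cell n m (x, s))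
    (entry_cell n m (exch n m right_sheet down_sheet (x, s)))"
proof -
  let ?f = "diagonal_step (grid_graph n m)" and ?k = "entry_cell n m"
  let ?g = "exch n m right_sheet down_sheet"
  \<comment> \<open>Here \<open>e\<close> plays the exit cell of the segment of \<open>y\<close>,
    and \<open>?f e\<close> lies on the segment of \<open>z\<close>.\<close>
  have via: "same_orbit ?f (?k y) (?k z)"
    if "same_orbit ?f (?k y) e" "same_orbit ?f (?k z) (?f e)" for y z e
    using that by (meson same_orbit_step same_orbit_sym same_orbit_trans)
  consider "x + 1 < n" | "x + 1 = n" | "n \<le> x" "x + 1 < n + m" | "x + 1 = n + m"
    using assms by linarith
  then show ?thesis
  proof cases
    case 1
    then have "same_orbit ?f (?k (x, s)) (place n m x (m - 1) s)"
      using assms same_orbit_entry_cell[of x n "m - 1" m s] by simp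
    moreover have "?f (place n m x (m - 1) s) = place n m (x + 1) 0 (right_sheet s)"
      using 1 assms by (simp add: diagonal_step_place)
    moreover have "m - 1 - 0 + (x + 1) = x + m"
      using assms by simp
    with 1 assms same_orbit_entry_cell[of "x + 1" n 0 m "right_sheet s"]
    have "same_orbit ?f (?k (?g (x, s))) (place n m (x + 1) 0 (right_sheet s))"
      by (simp only: exch_def) simp
    ultimately show ?thesis
      using via by metis
  next
    case 2
    then have "same_orbit ?f (?k (x, s)) (place n m x (m - 1) s)"
      using assms same_orbit_entry_cell[of x n "m - 1" m s] by simp
    moreover have "?f (place n m x (m - 1) s) = place n m 0 0 (down_sheet (right_sheet s))"
      using 2 assms by (simp add: diagonal_step_place)
    \<comment> \<open>The image has label \<open>n + m - 1\<close>, whose entry cell already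
      includes the downward exit, just as the single step at the corner crosses both
      borders.\<close>
    moreover have "?k (?g (x, s)) = place n m 0 0 (down_sheet (right_sheet s))"
      using 2 by (auto simp: exch_def entry_cell_def)
    ultimately show ?thesis
      using via by (metis same_orbit_refl)
  next
    case 3
    \<comment> \<open>The column \<open>n + m - 2 - x\<close> is that of the bottom-row cell with
      label \<open>x\<close>.\<close>
    have "n + m - 2 - x + 1 < m" "m - 1 - (n + m - 2 - x) + (n - 1) = x"
      "m - 1 - (n + m - 2 - x + 1) + 0 = x - n"
      using 3 assms by linarith+
    then obtain c where c: "c + 1 < m" "m - 1 - c + (n - 1) = x" "m - 1 - (c + 1) + 0 = x - n"
      by blast
    have "same_orbit ?f (?k (x, s)) (place n m (n - 1) c s)"
      using same_orbit_entry_cell[of "n - 1" n c m s] c(1) assms unfolding c(2) by simp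
    moreover have "?f (place n m (n - 1) c s) = place n m 0 (c + 1) (down_sheet s)"
      using c(1) assms by (simp add: diagonal_step_place)
    moreover have "?g (x, s) = (x - n, down_sheet s)"
      using 3 by (simp add: exch_def)
    then have "same_orbit ?f (?k (?g (x, s))) (place n m 0 (c + 1) (down_sheet s))"
      using same_orbit_entry_cell[of 0 n "c + 1" m "down_sheet s"] c(1) assms unfolding c(3) by simp
    ultimately show ?thesis
      using via by metis
  next
    case 4
    \<comment> \<open>The label without cells was assigned the entry cell of its successor.\<close>
    then have "?k (?g (x, s)) = ?k (x, s)"
      using assms by (auto simp: exch_def entry_cell_def)
    then show ?thesis by simp
  qed
qed

text \<open>A diagonal step costs no exchange step inside a block, one through a side, and two
  through a corner.\<close>

lemma label_diagonal_step:
  assumes "i < n" "c < m"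
  shows "same_orbit (exch n m right_sheet down_sheet) (label n m (place n m i c s))
    (label n m (diagonal_step (grid_graph n m) (place n m i c s)))"
proof (rule same_orbit_stepsI)
  let ?g = "exch n m right_sheet down_sheet" and ?z = "place n m i c s"
  let ?f = "diagonal_step (grid_graph n m)"
  note [simp] = diagonal_step_place label_place
  consider "c + 1 < m" "i + 1 < n" | "c + 1 = m" "i + 1 < n" | "c + 1 < m" "i + 1 = n"
    | "c + 1 = m" "i + 1 = n"
    using assms by linarith
  then show "label n m (?f ?z) = label n m ?z \<or> label n m (?f ?z) = ?g (label n m ?z) \<or>
    label n m (?f ?z) = ?g (?g (label n m ?z))"
  proof cases
    case 1
    then have "label n m (?f ?z) = label n m ?z" by simp
    then show ?thesis by blast
  next
    case 2
    then have "label n m (?f ?z) = ?g (label n m ?z)" by (auto simp: exch_def)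
    then show ?thesis by blast
  next
    case 3
    then have "label n m (?f ?z) = ?g (label n m ?z)" by (auto simp: exch_def)
    then show ?thesis by blast
  next
    case 4
    then have "label n m (?f ?z) = ?g (?g (label n m ?z))" by (auto simp: exch_def)
    then show ?thesis by blast
  qed
qed

lemma label_entry_cell:
  assumes "0 < n" "0 < m" "x < n + m"
  shows "same_orbit (exch n m right_sheet down_sheet) (label n m (entry_cell n m (x, s))) (x, s)"
proof (rule same_orbit_sym, rule same_orbit_stepsI)
  let ?g = "exch n m right_sheet down_sheet"
  consider "x < m" | "m \<le> x" "x + 1 < n + m" | "m \<le> x" "x + 1 = n + m"
    using assms by linarith
  then show "label n m (entry_cell n m (x, s)) = (x, s) \<or>
    label n m (entry_cell n m (x, s)) = ?g (x, s) \<or>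
    label n m (entry_cell n m (x, s)) = ?g (?g (x, s))"
  proof cases
    case 3
    then have "label n m (entry_cell n m (x, s)) = ?g (x, s)"
      using assms by (auto simp: entry_cell_def label_place exch_def)
    then show ?thesis by blast
  qed (use assms in \<open>auto simp: entry_cell_def label_place\<close>)
qed

lemma card_diagonals_grid_graph:
  assumes "0 < n" "0 < m"
  shows "card (diagonals (grid_graph n m)) = exch_orbits n m right_sheet down_sheet"
proof -
  let ?f = "diagonal_step (grid_graph n m)" and ?g = "exch n m right_sheet down_sheet"
  let ?Y = "{..<n + m} \<times> (UNIV :: sheet set)"
  have verts: "pverts (grid_graph n m) = cells n m"
    by (simp add: grid_graph_def)
  have "bij_betw (inv_into (cells n m) (up_cell n m) \<circ> right_cell n m) (cells n m) (cells n m)"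
    using bij_betw_right_cell bij_betw_inv_into[OF bij_betw_up_cell] by (rule bij_betw_trans)
  then have bij: "bij_betw ?f (cells n m) (cells n m)"
    by (simp add: diagonal_step_def[abs_def] grid_graph_def comp_def)
  have "orbit_count ?f (cells n m) = orbit_count ?g ?Y"
  proof (rule orbit_count_eqI[where h = "label n m" and k = "entry_cell n m"])
    show "?f z \<in> cells n m" if "z \<in> cells n m" for z
      using bij that by (rule bij_betwE[rule_format])
    show "?g y \<in> ?Y" if "y \<in> ?Y" for y
      using that by (rule exch_mem)
    show "label n m z \<in> ?Y" if "z \<in> cells n m" for z
      using that by (auto elim!: cells_placeE simp: label_place)
    show "entry_cell n m y \<in> cells n m" if "y \<in> ?Y" for y
      using assms that by (rule entry_cell_mem)
    show "same_orbit ?g (label n m z) (label n m (?f z))" if "z \<in> cells n m" for z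
      using that by (auto elim!: cells_placeE intro: label_diagonal_step)
    show "same_orbit ?f (entry_cell n m y) (entry_cell n m (?g y))" if "y \<in> ?Y" for y
      using same_orbit_entry_cell_exch[OF assms] that by auto
    show "same_orbit ?f (entry_cell n m (label n m z)) z" if "z \<in> cells n m" for z
      using that by (elim cells_placeE) (simp only: label_place same_orbit_entry_cell)
    show "same_orbit ?g (label n m (entry_cell n m y)) y" if "y \<in> ?Y" for y
      using that label_entry_cell[OF assms] by auto
  qed
  moreover have "finite (cells n m)"
    by (simp add: cells_def)
  ultimately show ?thesis
    using diagonals_eq_orbit_count[of "grid_graph n m"] bij by (simp add: verts exch_orbits_def)
qed

section \<open>The Euclidean algorithm as a program\<close>

text \<open>Writing constants to constant addresses costs nothing, and the number of writes is
  independent of the input, so the table adds only a constant to the true number of steps.\<close>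

primrec load :: "int \<Rightarrow> (int \<Rightarrow> int) \<Rightarrow> nat \<Rightarrow> program" where
  "load d \<tau> 0 = Skip"
| "load d \<tau> (Suc k) = Seq (load d \<tau> k) (Assign (Const (d + int k)) (Const (\<tau> (d + int k))))"

lemma runs_load:
  "runs (load d \<tau> N) s 0 (\<lambda>x. if d \<le> x \<and> x < d + int N then \<tau> x else s x)"
proof (induction N)
  case 0
  have "(\<lambda>x. if d \<le> x \<and> x < d + int 0 then \<tau> x else s x) = s"
    by auto
  then show ?case
    by (simp only: load.simps runs.Skip)
next
  case (Suc N)
  let ?s = "\<lambda>N x. if d \<le> x \<and> x < d + int N then \<tau> x else s x"
  have "(?s N)(d + int N := \<tau> (d + int N)) = ?s (Suc N)"
    by (auto simp: fun_eq_iff)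
  then have "runs (Assign (Const (d + int N)) (Const (\<tau> (d + int N)))) (?s N) 0 (?s (Suc N))"
    using runs.Assign[of "Const (d + int N)" "Const (\<tau> (d + int N))" "?s N"] by simp
  from runs.Seq[OF Suc.IH this] show ?case
    by simp
qed

abbreviation register :: "int \<Rightarrow> aexp" where
  "register i \<equiv> Cell (Const i)"

text \<open>
  Registers 0 and 1 hold the side lengths and register 2 the address of a table row that encodes
  the pair of sheet permutations. The first \<open>p\<close> entries of a row are the addresses of its successor
  rows, indexed by the quotient modulo \<open>p\<close>; the next entry is the number of cycles of the second
  permutation.
\<close>

definition euclid_step :: "nat \<Rightarrow> program" where
  "euclid_step p =
    Seq (Assign (Const 2) (Cell (Add (register 2)
          (Rem (Quot (register 1) (register 0)) (Const (int p))))))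
    (Seq (Assign (Const 3) (Rem (register 1) (register 0)))
    (Seq (Assign (Const 1) (register 0))
         (Assign (Const 0) (register 3))))"

definition euclid_loop :: "nat \<Rightarrow> program" where
  "euclid_loop p = While (Neg (Equal (register 0) (Const 0))) (euclid_step p)"

text \<open>Successor rows follow the update in \<open>exch_orbits_mod\<close>. Addresses from 4 on
  keep the table clear of the working registers 0 to 3.\<close>

definition table :: "nat \<Rightarrow> (('s \<Rightarrow> 's) \<times> ('s \<Rightarrow> 's) \<Rightarrow> int) \<Rightarrow> memory \<Rightarrow> bool" where
  "table p row s \<longleftrightarrow> (\<forall>A B. row (A, B) \<ge> 4 \<and>
    (\<forall>j<p. s (row (A, B) + int j) = row (B, (B ^^ j) \<circ> A)) \<and>
    s (row (A, B) + int p) = int (orbit_count B UNIV))"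

definition encodes ::
  "nat \<Rightarrow> (('s \<Rightarrow> 's) \<times> ('s \<Rightarrow> 's) \<Rightarrow> int) \<Rightarrow> nat \<Rightarrow> nat \<Rightarrow> ('s \<Rightarrow> 's) \<Rightarrow> ('s \<Rightarrow> 's) \<Rightarrow> memory \<Rightarrow> bool"
  where "encodes p row a b A B s \<longleftrightarrow>
    table p row s \<and> s 0 = int a \<and> s 1 = int b \<and> s 2 = row (A, B)"

section \<open>Correctness and cost of the division loop\<close>

lemma funpow_mod_period:
  assumes "f ^^ p = id"
  shows "f ^^ (k mod p) = f ^^ k"
proof -
  have "f ^^ (p * (k div p)) = id"
    by (simp add: funpow_mult[symmetric] assms)
  then show ?thesis
    using funpow_add[of "p * (k div p)" "k mod p" f] by simp
qed

lemma runs_euclid_step: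
  assumes "encodes p row a b A B s" "p > 0" "B ^^ p = id"
  shows "\<exists>s'. runs (euclid_step p) s 4 s' \<and>
    encodes p row (b mod a) a B ((B ^^ (b div a)) \<circ> A) s'"
proof -
  let ?j = "b div a mod p"
  let ?s1 = "s(2 := row (B, (B ^^ (b div a)) \<circ> A))"
  let ?s2 = "?s1(3 := int (b mod a))"
  let ?s3 = "?s2(1 := int a)"
  let ?s4 = "?s3(0 := int (b mod a))"
  have s: "s 0 = int a" "s 1 = int b" "s 2 = row (A, B)" "table p row s"
    using assms(1) unfolding encodes_def by auto
  \<comment> \<open>The table is indexed by the residue of the quotient, which the period
    \<open>p\<close> makes sufficient.\<close>
  have "s (row (A, B) + int ?j) = row (B, (B ^^ (b div a)) \<circ> A)"
    using s(4) \<open>p > 0\<close> funpow_mod_period[OF assms(3)] unfolding table_def by simp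
  moreover have "int b div int a mod int p = int ?j"
    by (simp add: zdiv_int zmod_int)
  ultimately have "runs (Assign (Const 2) (Cell (Add (register 2)
      (Rem (Quot (register 1) (register 0)) (Const (int p)))))) s 3 ?s1"
    using runs.Assign[of "Const 2" "Cell (Add (register 2)
      (Rem (Quot (register 1) (register 0)) (Const (int p))))" s] s(1-3)
    by (simp add: eval_nat_numeral)
  moreover have "runs (Assign (Const 3) (Rem (register 1) (register 0))) ?s1 1 ?s2"
    using runs.Assign[of "Const 3" "Rem (register 1) (register 0)" ?s1] s by (simp add: zmod_int)
  moreover have "runs (Assign (Const 1) (register 0)) ?s2 0 ?s3"
    using runs.Assign[of "Const 1" "register 0" ?s2] s by simp
  moreover have "runs (Assign (Const 0) (register 3)) ?s3 0 ?s4"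
    using runs.Assign[of "Const 0" "register 3" ?s3] by simp
  ultimately have "runs (euclid_step p) s (3 + (1 + (0 + 0))) ?s4"
    unfolding euclid_step_def by (intro runs.Seq)
  moreover have "table p row ?s4"
    unfolding table_def
  proof (intro allI conjI impI)
    fix A' B'
    have ge: "row (A', B') \<ge> 4"
      using s(4) unfolding table_def by blast
    then show "row (A', B') \<ge> 4" .
    have "?s4 (row (A', B') + int j) = s (row (A', B') + int j)" for j
      using ge by simp
    then show "?s4 (row (A', B') + int p) = int (orbit_count B' UNIV)"
      and "\<And>j. j < p \<Longrightarrow> ?s4 (row (A', B') + int j) = row (B', (B' ^^ j) \<circ> A')"
      using s(4) unfolding table_def by simp_all
  qed
  ultimately show ?thesis
    unfolding encodes_def by (intro exI[of _ ?s4]) simp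
qed

text \<open>The remainder is below \<open>a\<close> and at most \<open>b - a\<close>; adding the two
  bounds gives \<open>2 * (b mod a) < b\<close>. Halving the product of the sides bounds the number
  of iterations.\<close>

lemma euclid_product_decreases:
  fixes a b :: nat
  assumes "0 < a" "a \<le> b"
  shows "2 * ((b mod a) * a) < a * b"
proof -
  have "b mod a < a" using assms by simp
  moreover have "b mod a = (b - a) mod a"
    using assms by (simp add: le_mod_geq)
  moreover have "(b - a) mod a \<le> b - a"
    by (rule mod_less_eq_dividend)
  ultimately have "2 * (b mod a) < b" using assms by linarith
  then show ?thesis using assms by (simp add: mult.commute)
qed

text \<open>The 5 is one loop test plus the 4 operations of the body. Stated as a transfer of runs,
  it also lets the first iteration be split off.\<close>

lemma runs_euclid_loop_step:
  assumes "encodes p row a b A B s" "p > 0" "B ^^ p = id" "a > 0"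
  shows "\<exists>s1. encodes p row (b mod a) a B ((B ^^ (b div a)) \<circ> A) s1 \<and>
    (\<forall>t s'. runs (euclid_loop p) s1 t s' \<longrightarrow> runs (euclid_loop p) s (5 + t) s')"
proof -
  let ?b = "Neg (Equal (register 0) (Const 0))"
  obtain s1 where s1: "runs (euclid_step p) s 4 s1"
    "encodes p row (b mod a) a B ((B ^^ (b div a)) \<circ> A) s1"
    using runs_euclid_step[OF assms(1-3)] by blast
  have "bval ?b s"
    using assms(1,4) by (simp add: encodes_def)
  then have "runs (euclid_loop p) s (bcost ?b + 4 + t) s'" if "runs (euclid_loop p) s1 t s'" for t s'
    using s1(1) that unfolding euclid_loop_def by (rule runs.WhileTrue)
  then show ?thesis
    using s1(2) by auto
qed

text \<open>The potential \<open>1 + 2 * (a * b)\<close> at least doubles \<open>2 ^ k\<close> per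
  iteration because the product more than halves; strictness absorbs the 1. The product of memory
  contents is what the output instruction will compute.\<close>

lemma runs_euclid_loop:
  assumes per: "\<And>B :: 's \<Rightarrow> 's. bij B \<Longrightarrow> B ^^ p = id" and "p > 0"
    and "encodes p row a b A B s" "bij A" "bij B" "a \<le> b"
  shows "\<exists>k s'. runs (euclid_loop p) s (5 * k + 1) s' \<and> 2 ^ k \<le> 1 + 2 * (a * b) \<and>
    s' 1 * s' (s' 2 + int p) = int (exch_orbits a b A (B :: 's \<Rightarrow> 's))"
  using assms(3-)
proof (induction a arbitrary: b A B s rule: less_induct)
  case (less a)
  show ?case
  proof (cases "a = 0")
    case True
    then have "runs (euclid_loop p) s 1 s"
      using runs.WhileFalse[of "Neg (Equal (register 0) (Const 0))" s] less.prems(1)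
      unfolding euclid_loop_def encodes_def by simp
    moreover have "s 1 * s (s 2 + int p) = int (exch_orbits a b A B)"
      using True less.prems(1) by (simp add: encodes_def table_def exch_orbits_0)
    ultimately show ?thesis
      by (intro exI[of _ 0]) (auto simp: True)
  next
    case False
    obtain s1 where s1: "encodes p row (b mod a) a B ((B ^^ (b div a)) \<circ> A) s1"
      "\<And>t s'. runs (euclid_loop p) s1 t s' \<Longrightarrow> runs (euclid_loop p) s (5 + t) s'"
      using runs_euclid_loop_step[OF less.prems(1) \<open>p > 0\<close> per[OF less.prems(3)]] False by blast
    have bij: "bij ((B ^^ (b div a)) \<circ> A)"
      using less.prems(2,3) bij_comp bij_fn by blast
    have lt: "b mod a < a"
      using False by simp
    obtain k s' where k: "runs (euclid_loop p) s1 (5 * k + 1) s'"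
      "2 ^ k \<le> 1 + 2 * ((b mod a) * a)"
      "s' 1 * s' (s' 2 + int p) = int (exch_orbits (b mod a) a B ((B ^^ (b div a)) \<circ> A))"
      using less.IH[OF lt s1(1) less.prems(3) bij less_imp_le[OF lt]] by blast
    have "runs (euclid_loop p) s (5 * Suc k + 1) s'"
      using s1(2)[OF k(1)] by (simp add: algebra_simps)
    moreover have "2 * ((b mod a) * a) < a * b"
      using False less.prems(4) by (intro euclid_product_decreases) simp_all
    then have "2 ^ Suc k \<le> 1 + 2 * (a * b)"
      using k(2) unfolding power_Suc by linarith
    ultimately show ?thesis
      using k(3) unfolding exch_orbits_mod[of a b A B] by blast
  qed
qed

section \<open>Construction of the table and of the complete program\<close>

lemma table_exists:
  "\<exists>(row :: ('s::finite \<Rightarrow> 's) \<times> ('s \<Rightarrow> 's) \<Rightarrow> int) \<tau> (N :: nat).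
    \<forall>s. (\<forall>x. 4 \<le> x \<and> x < 4 + int N \<longrightarrow> s x = \<tau> x) \<longrightarrow> table p row s"
proof -
  obtain e :: "('s \<Rightarrow> 's) \<times> ('s \<Rightarrow> 's) \<Rightarrow> nat" and M where e: "range e = {i. i < M}" "inj e"
    using finite_imp_inj_to_nat_seg[of "UNIV :: (('s \<Rightarrow> 's) \<times> ('s \<Rightarrow> 's)) set"] by auto
  \<comment> \<open>Pairs are numbered by \<open>e\<close> and get consecutive rows of
    \<open>p + 1\<close> entries; \<open>\<tau>\<close> decodes an address by division by
    \<open>p + 1\<close>.\<close>
  define row where "row z = 4 + int (e z * (p + 1))" for z
  define \<tau> where "\<tau> x = (let y = nat (x - 4); (A, B) = inv e (y div (p + 1)); j = y mod (p + 1)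
    in if j < p then row (B, (B ^^ j) \<circ> A) else int (orbit_count B UNIV))" for x
  have \<tau>: "\<tau> (row (A, B) + int j) = (if j < p then row (B, (B ^^ j) \<circ> A) else int (orbit_count B UNIV))"
    if "j \<le> p" for A B j
  proof -
    have "row (A, B) + int j - 4 = int (j + e (A, B) * (p + 1))"
      unfolding row_def by simp
    then have "nat (row (A, B) + int j - 4) = j + e (A, B) * (p + 1)"
      by (simp only: nat_int)
    moreover have "(j + e (A, B) * (p + 1)) div (p + 1) = e (A, B)"
      and "(j + e (A, B) * (p + 1)) mod (p + 1) = j"
      using that by (simp_all only: div_mult_self1 mod_mult_self1) simp_all
    ultimately show ?thesis
      unfolding \<tau>_def by (simp only: Let_def inv_f_f[OF e(2)] prod.case)
  qed
  have bound: "4 \<le> row z + int j" "row z + int j < 4 + int (M * (p + 1))" if "j \<le> p" for z j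
  proof -
    have "e z + 1 \<le> M"
      using e(1) by (metis Suc_eq_plus1 Suc_leI mem_Collect_eq rangeI)
    then have "(e z + 1) * (p + 1) \<le> M * (p + 1)"
      by (rule mult_le_mono1)
    then have "e z * (p + 1) + j < M * (p + 1)"
      using that by simp
    then have "int (e z * (p + 1) + j) < int (M * (p + 1))"
      by (simp only: of_nat_less_iff)
    then show "4 \<le> row z + int j" "row z + int j < 4 + int (M * (p + 1))"
      unfolding row_def by simp_all
  qed
  have "table p row s" if "\<forall>x. 4 \<le> x \<and> x < 4 + int (M * (p + 1)) \<longrightarrow> s x = \<tau> x" for s
  proof -
    have "s (row z + int j) = \<tau> (row z + int j)" if "j \<le> p" for z j
      using \<open>\<forall>x. _ x\<close> bound[OF that] by blast
    then show ?thesis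
      unfolding table_def using \<tau> bound(1)[of 0] by simp
  qed
  then show ?thesis by blast
qed

lemma sheet_program_exists:
  fixes A B :: "'s::finite \<Rightarrow> 's"
  assumes "bij A" "bij B"
  shows "\<exists>P. \<forall>a b. a > 0 \<longrightarrow> (\<exists>k s. runs P (initial (int a) (int b)) (5 * k + 8) s \<and>
    2 ^ k \<le> 1 + 2 * a\<^sup>2 \<and> result s = int (exch_orbits a b A B))"
proof -
  obtain p :: nat where p: "p > 0" "\<And>B :: 's \<Rightarrow> 's. bij B \<Longrightarrow> B ^^ p = id"
    using finite_uniform_period by blast
  obtain row :: "('s \<Rightarrow> 's) \<times> ('s \<Rightarrow> 's) \<Rightarrow> int" and \<tau> N
    where row: "\<forall>s. (\<forall>x. 4 \<le> x \<and> x < 4 + int N \<longrightarrow> s x = \<tau> x) \<longrightarrow> table p row s"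
    using table_exists by blast
  let ?out = "Mul (register 1) (Cell (Add (register 2) (Const (int p))))"
  let ?P = "Seq (load 4 \<tau> N) (Seq (Assign (Const 2) (Const (row (A, B))))
    (Seq (euclid_loop p) (Assign (Const 0) ?out)))"
  have "\<exists>k s. runs ?P (initial (int a) (int b)) (5 * k + 8) s \<and>
    2 ^ k \<le> 1 + 2 * a\<^sup>2 \<and> result s = int (exch_orbits a b A B)" if a_pos: "a > 0" for a b
  proof -
    let ?s0 = "initial (int a) (int b)"
    let ?s1 = "\<lambda>x. if 4 \<le> x \<and> x < 4 + int N then \<tau> x else ?s0 x"
    let ?s2 = "?s1(2 := row (A, B))"
    have load: "runs (load 4 \<tau> N) ?s0 0 ?s1"
      by (rule runs_load)
    have assign: "runs (Assign (Const 2) (Const (row (A, B)))) ?s1 0 ?s2"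
      using runs.Assign[of "Const 2" "Const (row (A, B))" ?s1] by simp
    have "table p row ?s2"
      by (rule row[rule_format]) simp
    then have enc: "encodes p row a b A B ?s2"
      by (simp add: encodes_def initial_def)
    \<comment> \<open>The first iteration is executed separately, since \<open>b\<close> may be
      arbitrarily large or smaller than \<open>a\<close>. Afterwards the sides are
      \<open>b mod a < a\<close>, so the bound depends on \<open>a\<close> alone.\<close>
    obtain s3 where s3: "encodes p row (b mod a) a B ((B ^^ (b div a)) \<circ> A) s3"
      "\<And>t s'. runs (euclid_loop p) s3 t s' \<Longrightarrow> runs (euclid_loop p) ?s2 (5 + t) s'"
      using runs_euclid_loop_step[OF enc p(1) p(2)[OF assms(2)] a_pos] by blast
    have bij: "bij ((B ^^ (b div a)) \<circ> A)"
      using assms bij_comp bij_fn by blast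
    have lt: "b mod a < a"
      using a_pos by simp
    obtain k s4 where k: "runs (euclid_loop p) s3 (5 * k + 1) s4"
      "2 ^ k \<le> 1 + 2 * ((b mod a) * a)"
      "s4 1 * s4 (s4 2 + int p) = int (exch_orbits (b mod a) a B ((B ^^ (b div a)) \<circ> A))"
      using runs_euclid_loop[OF p(2) p(1) s3(1) assms(2) bij less_imp_le[OF lt]] by blast
    have "runs (Assign (Const 0) ?out) s4 2 (s4(0 := s4 1 * s4 (s4 2 + int p)))"
      using runs.Assign[of "Const 0" ?out s4] by (simp add: eval_nat_numeral)
    \<comment> \<open>The 8 consists of 5 for the split-off iteration, 1 for the final loop test and
      2 for the output.\<close>
    from runs.Seq[OF load runs.Seq[OF assign runs.Seq[OF s3(2)[OF k(1)] this]]]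
    have "runs ?P ?s0 (5 * k + 8) (s4(0 := s4 1 * s4 (s4 2 + int p)))"
      by (simp add: algebra_simps)
    moreover have "(b mod a) * a \<le> a\<^sup>2"
      using lt by (simp add: power2_eq_square)
    then have "2 ^ k \<le> 1 + 2 * a\<^sup>2"
      using k(2) by linarith
    moreover have "result (s4(0 := s4 1 * s4 (s4 2 + int p))) = int (exch_orbits a b A B)"
      using k(3) by (simp add: result_def exch_orbits_mod[of a b])
    ultimately show ?thesis by blast
  qed
  then show ?thesis by blast
qed

section \<open>From the iteration bound to the logarithm\<close>

lemma linear_le_ln:
  fixes k n :: nat
  assumes "n > 1" "2 ^ k \<le> 1 + 2 * n\<^sup>2"
  shows "real (5 * k + 8) \<le> 28 / ln 2 * ln (real n)"
proof -
  have "4 * 1 \<le> n\<^sup>2"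
    using assms(1) power_mono[of 2 n 2] by simp
  then have "2 ^ k \<le> 4 * n\<^sup>2"
    using assms(2) by linarith
  then have "real (2 ^ k) \<le> real (4 * n\<^sup>2)"
    by (simp only: of_nat_le_iff)
  then have "ln (2 ^ k :: real) \<le> ln (2\<^sup>2 * (real n)\<^sup>2)"
    using assms(1) by (subst ln_le_cancel_iff) simp_all
  also have "\<dots> = 2 * ln 2 + 2 * ln (real n)"
    using assms(1) by (simp only: ln_mult ln_realpow) (simp add: ln_mult ln_realpow)
  finally have "real k * ln 2 \<le> 2 * ln 2 + 2 * ln (real n)"
    by (simp add: ln_realpow)
  moreover have "ln 2 \<le> ln (real n)"
    using assms(1) by simp
  \<comment> \<open>Five times the bound on \<open>real k * ln 2\<close> plus
    \<open>8 * ln 2\<close> is \<open>18 * ln 2 + 10 * ln (real n)\<close>, and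
    \<open>ln 2 \<le> ln (real n)\<close> turns this into 28.\<close>
  ultimately have "(5 * real k + 8) * ln 2 \<le> 28 * ln (real n)"
    by (simp add: algebra_simps)
  then show ?thesis
    by (simp add: field_simps)
qed

theorem mainTheorem2:
  shows "\<exists>(P :: program) (C :: real). \<forall>n m :: nat. n > 1 \<and> m > 1 \<longrightarrow>
    (\<exists>t s. runs P (initial (int n) (int m)) t s \<and>
           result s = int (card (diagonals (grid_graph n m))) \<and>
           real t \<le> C * ln (real n))"
proof -
  obtain P where P: "\<forall>a b. a > 0 \<longrightarrow> (\<exists>k s. runs P (initial (int a) (int b)) (5 * k + 8) s \<and>
      2 ^ k \<le> 1 + 2 * a\<^sup>2 \<and> result s = int (exch_orbits a b right_sheet down_sheet))"
    using sheet_program_exists[OF bij_right_sheet bij_down_sheet] by blast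
  have "\<exists>t s. runs P (initial (int n) (int m)) t s \<and>
      result s = int (card (diagonals (grid_graph n m))) \<and>
      real t \<le> 28 / ln 2 * ln (real n)" if "n > 1" "m > 1" for n m :: nat
  proof -
    obtain k s where "runs P (initial (int n) (int m)) (5 * k + 8) s" "2 ^ k \<le> 1 + 2 * n\<^sup>2"
      "result s = int (exch_orbits n m right_sheet down_sheet)"
      using P \<open>n > 1\<close> by (meson less_trans zero_less_one)
    moreover have "card (diagonals (grid_graph n m)) = exch_orbits n m right_sheet down_sheet"
      using that by (intro card_diagonals_grid_graph) simp_all
    ultimately show ?thesis
      using linear_le_ln[OF \<open>n > 1\<close>] by metis
  qed
  then show ?thesis by blast
qed

end
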